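(* Let $\mathbb{L}$ be a ring, let $m\in\mathbb{N}\cup\{\infty\}$, and let $a\in\mathbb{L}$. Let $n\in\mathbb{N}$ be such that $n<m$. Let $b\in\mathbb{L}$. Then $$(ba)^n = e_0^T\,(U_bS)^n\,H_1 .$$
   Context: $\mathbb{N}=\{0,1,2,\ldots\}$. "Ring" means associative ring with unity, not necessarily commutative. For $a,b\in\mathbb{L}$, $[a,b]=ab-ba$, and $\operatorname{ad}_a:\mathbb{L}\to\mathbb{L}$ is the map $\operatorname{ad}_a(b)=[a,b]$; $\operatorname{ad}_a^k$ is its $k$-fold composition ($\operatorname{ad}_a^0=\operatorname{id}$). Matrices have entries in $\mathbb{L}$; rows and columns are indexed starting from $0$. If $m=\infty$, then "$0\le i<m$" means $i\in\mathbb{N}$, and $n<\infty$ for every $n\in\mathbb{N}$; matrices may then be infinite, and products are given by $(AB)_{i,k}=\sum_j A_{i,j}B_{j,k}$. For the matrices below all these sums have only finitely many nonzero terms, and multiplication is associative. A $1\times 1$-matrix is identified with its unique entry. $A^T$ is the transpose of $A$; $A^0$ is the identity matrix. Define the following (with $a$ and $m$ fixed; $[\mathcal{A}]$ denotes $1$ if the statement $\mathcal{A}$ is true and $0$ otherwise): - $S$ is the $m\times m$-matrix with $(i,j)$-th entry $[j=i+1]$. - For $b\in\mathbb{L}$, $U_b$ is the $m\times m$-matrix with $(i,j)$-th entry $\binom{i}{j}\operatorname{ad}_a^{i-j}(b)$ if $i\ge j$, and $0$ if $i<j$. - For $c\in\mathbb{L}$, $H_c$ is the column vector of size $m$ whose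 $i$-th entry is $a^ic$ ($0\le i<m$). - For an integer $j$ with $0\le j<m$, $e_j$ is the column vector of size $m$ whose $p$-th entry is $[p=j]$. *)

theory Defs
  imports Complex_Main "HOL-Library.Extended_Nat" "HOL-Library.Groups_Big_Fun"
begin

text \<open>
  Associative unital rings are types of sort \<open>{ring, monoid_mult}\<close>. The class \<open>ring_1\<close> would
  in addition require \<open>0 \<noteq> 1\<close> and so exclude the zero ring. Since \<open>of_nat\<close> is not
  available at this sort, natural multiples are written as repeated sums.
\<close>

definition nat_multiple :: "nat \<Rightarrow> 'a::comm_monoid_add \<Rightarrow> 'a" where
  "nat_multiple k x = (\<Sum>_<k. x)"

definition ad :: "'a::ring \<Rightarrow> 'a \<Rightarrow> 'a" where
  "ad a b = a * b - b * a"

text \<open>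
  A matrix of size \<open>r\<close> by \<open>c\<close>, where \<open>r\<close> and \<open>c\<close> may be infinite, is a function of two
  natural indices (starting from 0) that is extended by 0 outside its index range.
\<close>

type_synonym 'a matrix = "nat \<Rightarrow> nat \<Rightarrow> 'a"

definition mk_matrix :: "enat \<Rightarrow> enat \<Rightarrow> (nat \<Rightarrow> nat \<Rightarrow> 'a::zero) \<Rightarrow> 'a matrix" where
  "mk_matrix r c f = (\<lambda>i j. if enat i < r \<and> enat j < c then f i j else 0)"

text \<open>
  \<open>Sum_any\<close> is the sum over all indices with a nonzero term. Because of the extension by 0,
  summing over all natural \<open>j\<close> is summing over the common dimension. If there are infinitely
  many nonzero terms, the value is 0; this does not occur for products of the row-finite
  matrices considered here.
\<close>

definition matrix_mult :: "'a::ring matrix \<Rightarrow> 'a matrix \<Rightarrow> 'a matrix" (infixl "\<bullet>\<^sub>m" 70) where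
  "A \<bullet>\<^sub>m B = (\<lambda>i k. Sum_any (\<lambda>j. A i j * B j k))"

definition matrix_transpose :: "'a matrix \<Rightarrow> 'a matrix" where
  "matrix_transpose A = (\<lambda>i j. A j i)"

definition identity_matrix :: "enat \<Rightarrow> 'a::{ring, monoid_mult} matrix" where
  "identity_matrix m = mk_matrix m m (\<lambda>i j. if i = j then 1 else 0)"

primrec matrix_power :: "enat \<Rightarrow> 'a::{ring, monoid_mult} matrix \<Rightarrow> nat \<Rightarrow> 'a matrix" where
  "matrix_power m A 0 = identity_matrix m"
| "matrix_power m A (Suc n) = matrix_power m A n \<bullet>\<^sub>m A"

definition S_mat :: "enat \<Rightarrow> 'a::{ring, monoid_mult} matrix" where
  "S_mat m = mk_matrix m m (\<lambda>i j. if j = i + 1 then 1 else 0)"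

definition U_mat :: "enat \<Rightarrow> 'a::ring \<Rightarrow> 'a \<Rightarrow> 'a matrix" where
  "U_mat m a b = mk_matrix m m
     (\<lambda>i j. if i \<ge> j then nat_multiple (i choose j) ((ad a ^^ (i - j)) b) else 0)"

definition H_vec :: "enat \<Rightarrow> 'a::{ring, monoid_mult} \<Rightarrow> 'a \<Rightarrow> 'a matrix" where
  "H_vec m a c = mk_matrix m 1 (\<lambda>i _. a ^ i * c)"

definition e_vec :: "enat \<Rightarrow> nat \<Rightarrow> 'a::{ring, monoid_mult} matrix" where
  "e_vec m j = mk_matrix m 1 (\<lambda>p _. if p = j then 1 else 0)"

text \<open>The identification of a 1 by 1 matrix with its unique entry.\<close>

definition the_entry :: "'a matrix \<Rightarrow> 'a" where
  "the_entry A = A 0 0"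

end

theory Submission imports Defs
begin

text \<open>
  Moving a power of \<open>a\<close> from the left of \<open>b\<close> to its right produces iterated commutators:
  \<open>a\<^sup>i b = (\<Sum>j\<le>i. (i choose j) ad\<^sub>a\<^sup>i\<^sup>-\<^sup>j(b) a\<^sup>j)\<close> (lemma \<open>power_mult_eq_sum_ad\<close>).
  Since the coefficients form row \<open>i\<close> of \<open>U\<^sub>b\<close>, this says \<open>U\<^sub>b H\<^sub>c = H\<^bsub>bc\<^esub>\<close>. The matrix \<open>S\<close>
  shifts the entries of a column up, so \<open>S H\<^sub>c = H\<^bsub>ac\<^esub>\<close> except that a finite \<open>m\<close> forces the last
  entry to be 0. Hence \<open>U\<^sub>b S H\<^sub>c\<close> and \<open>H\<^bsub>bac\<^esub>\<close> agree in every row but the last, and iterating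
  suggests \<open>(U\<^sub>b S)\<^sup>n H\<^sub>1 = H\<^bsub>(ba)^n\<^esub>\<close>, whose top entry is \<open>(ba)\<^sup>n\<close>.

  What remains is that the defect in the last row does not reach the top row. The matrix
  \<open>U\<^sub>b S\<close> has only zeros above its first superdiagonal, so row \<open>i\<close> of \<open>(U\<^sub>b S)\<^sup>n\<close> is supported
  on columns up to \<open>i + n\<close> (lemma \<open>power_US_eq_0\<close>). As long as \<open>i + n < m\<close>, no step of the
  iteration uses the defective last row (lemma \<open>power_US_row_times_H\<close>). The same support bound
  turns all matrix products involved into finite sums with explicit bounds, which can be
  interchanged.
\<close>

section \<open>Commuting a power past an element\<close>

lemma nat_multiple_0: "nat_multiple 0 x = 0"
  by (simp add: nat_multiple_def)

lemma nat_multiple_1: "nat_multiple (Suc 0) x = x"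
  by (simp add: nat_multiple_def)

lemma nat_multiple_add_left: "nat_multiple (k + l) x = nat_multiple k x + nat_multiple l x"
  by (induction l) (simp_all add: nat_multiple_def add.assoc)

lemma nat_multiple_add_right: "nat_multiple k (x + y) = nat_multiple k x + nat_multiple k y"
  by (simp add: nat_multiple_def sum.distrib)

lemma nat_multiple_mult_left: "nat_multiple k x * y = nat_multiple k (x * y)"
  for x y :: "'a::ring"
  by (simp add: nat_multiple_def sum_distrib_right)

lemma nat_multiple_mult_right: "y * nat_multiple k x = nat_multiple k (y * x)"
  for x y :: "'a::ring"
  by (simp add: nat_multiple_def sum_distrib_left)

text \<open>
  Left multiplication by \<open>a\<close> is the sum of \<open>ad a\<close> and right multiplication by \<open>a\<close>, and these
  two operators commute; the identity is the binomial theorem for them, applied to \<open>b\<close>.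
\<close>

lemma power_mult_eq_sum_ad:
  fixes a b :: "'a::{ring, monoid_mult}"
  shows "a ^ i * b = (\<Sum>j\<le>i. nat_multiple (i choose j) ((ad a ^^ (i - j)) b) * a ^ j)"
proof (induction i)
  case 0
  show ?case by (simp add: nat_multiple_1)
next
  case (Suc i)
  define t where "t k j = nat_multiple k ((ad a ^^ (Suc i - j)) b * a ^ j)" for k j
  have step: "a * (nat_multiple (i choose j) ((ad a ^^ (i - j)) b) * a ^ j)
      = t (i choose j) j + t (i choose j) (Suc j)" if "j \<le> i" for j
  proof -
    let ?x = "(ad a ^^ (i - j)) b"
    have "a * ?x = (ad a ^^ (Suc i - j)) b + ?x * a"
      using that by (simp add: Suc_diff_le ad_def)
    then have "a * (?x * a ^ j) = (ad a ^^ (Suc i - j)) b * a ^ j + ?x * a ^ Suc j"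
      by (simp add: mult.assoc[symmetric] distrib_right)
    then show ?thesis
      by (simp add: t_def nat_multiple_mult_left nat_multiple_mult_right nat_multiple_add_right)
  qed
  have "a ^ Suc i * b = a * (a ^ i * b)"
    by (simp add: mult.assoc)
  also have "\<dots> = (\<Sum>j\<le>i. a * (nat_multiple (i choose j) ((ad a ^^ (i - j)) b) * a ^ j))"
    by (simp only: Suc.IH sum_distrib_left)
  also have "\<dots> = (\<Sum>j\<le>i. t (i choose j) j) + (\<Sum>j\<le>i. t (i choose j) (Suc j))"
    by (simp add: step sum.distrib)
  also have "(\<Sum>j\<le>i. t (i choose j) j) = (\<Sum>j\<le>Suc i. t (i choose j) j)"
    by (simp add: t_def nat_multiple_0 binomial_eq_0)
  also have "\<dots> = t 1 0 + (\<Sum>j\<le>i. t (i choose Suc j) (Suc j))"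
    by (simp add: sum.atMost_Suc_shift del: sum.atMost_Suc)
  also have "t 1 0 + (\<Sum>j\<le>i. t (i choose Suc j) (Suc j)) + (\<Sum>j\<le>i. t (i choose j) (Suc j))
      = t 1 0 + (\<Sum>j\<le>i. t (Suc i choose Suc j) (Suc j))"
    by (simp add: t_def nat_multiple_add_left sum.distrib add_ac)
  also have "\<dots> = (\<Sum>j\<le>Suc i. t (Suc i choose j) j)"
    by (simp add: sum.atMost_Suc_shift del: sum.atMost_Suc)
  finally show ?case
    by (simp only: t_def nat_multiple_mult_left)
qed

section \<open>Rows with bounded support\<close>

lemma matrix_mult_row_bounded:
  assumes "\<And>j. j > q \<Longrightarrow> A i j = 0"
  shows "(A \<bullet>\<^sub>m B) i k = (\<Sum>j\<le>q. A i j * B j k)"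
  unfolding matrix_mult_def
proof (rule Sum_any.expand_superset)
  show "{j. A i j * B j k \<noteq> 0} \<subseteq> {..q}"
    using assms by (force simp: not_le[symmetric])
qed simp

lemma U_entry:
  "U_mat m a b i j = (if enat i < m \<and> enat j < m \<and> j \<le> i
    then nat_multiple (i choose j) ((ad a ^^ (i - j)) b) else 0)"
  by (simp add: U_mat_def mk_matrix_def)

text \<open>
  Right multiplication by \<open>S\<close> shifts the columns of \<open>U\<^sub>b\<close> to the right; for finite \<open>m\<close> the last
  column of \<open>U\<^sub>b\<close> is pushed out.
\<close>

lemma US_entry:
  fixes a b :: "'a::{ring, monoid_mult}"
  shows "(U_mat m a b \<bullet>\<^sub>m S_mat m) i k =
    (if 0 < k \<and> enat k < m then U_mat m a b i (k - 1) else 0)"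
proof -
  have "(U_mat m a b \<bullet>\<^sub>m S_mat m) i k = (\<Sum>j\<le>i. U_mat m a b i j * S_mat m j k)"
    by (rule matrix_mult_row_bounded) (simp add: U_entry)
  also have "\<dots> = (\<Sum>j\<le>i. if j = k - 1
      then (if 0 < k \<and> enat k < m then U_mat m a b i (k - 1) else 0) else 0)"
    by (rule sum.cong) (auto simp: U_entry S_mat_def mk_matrix_def)
  also have "\<dots> = (if 0 < k \<and> enat k < m then U_mat m a b i (k - 1) else 0)"
    by (auto simp: U_entry)
  finally show ?thesis .
qed

lemma US_eq_0:
  fixes a b :: "'a::{ring, monoid_mult}"
  assumes "k > Suc i"
  shows "(U_mat m a b \<bullet>\<^sub>m S_mat m) i k = 0"
  using assms by (auto simp: US_entry U_entry)

lemma power_US_eq_0: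
  fixes a b :: "'a::{ring, monoid_mult}"
  assumes "k > i + n"
  shows "matrix_power m (U_mat m a b \<bullet>\<^sub>m S_mat m) n i k = 0"
  using assms
proof (induction n arbitrary: k)
  case 0
  then show ?case by (simp add: identity_matrix_def mk_matrix_def)
next
  case (Suc n)
  have "matrix_power m (U_mat m a b \<bullet>\<^sub>m S_mat m) (Suc n) i k =
     (\<Sum>j\<le>i + n. matrix_power m (U_mat m a b \<bullet>\<^sub>m S_mat m) n i j * (U_mat m a b \<bullet>\<^sub>m S_mat m) j k)"
    unfolding matrix_power.simps by (rule matrix_mult_row_bounded) (rule Suc.IH)
  also have "\<dots> = 0"
    by (rule sum.neutral) (use Suc.prems in \<open>simp add: US_eq_0\<close>)
  finally show ?case .
qed

section \<open>Action on the column of powers\<close>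

text \<open>
  This is \<open>U\<^sub>b S H\<^sub>1 = H\<^bsub>ba\<^esub>\<close> in a row other than the last. The bound \<open>q\<close> is a parameter because
  rows with different supports have to be summed over one common range.
\<close>

lemma US_row_times_H:
  fixes a b :: "'a::{ring, monoid_mult}"
  assumes "enat (Suc i) < m" and "i \<le> q"
  shows "(\<Sum>k\<le>Suc q. (U_mat m a b \<bullet>\<^sub>m S_mat m) i k * a ^ k) = a ^ i * (b * a)"
proof -
  have less: "enat j < m" if "j \<le> Suc i" for j
    using that assms(1) by (meson enat_ord_simps(1) le_less_trans)
  have "(\<Sum>k\<le>Suc q. (U_mat m a b \<bullet>\<^sub>m S_mat m) i k * a ^ k)
      = (\<Sum>k\<le>Suc i. (U_mat m a b \<bullet>\<^sub>m S_mat m) i k * a ^ k)"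
    by (rule sum.mono_neutral_right) (use assms(2) in \<open>auto simp: US_eq_0\<close>)
  also have "\<dots> = (\<Sum>j\<le>i. (U_mat m a b \<bullet>\<^sub>m S_mat m) i (Suc j) * a ^ Suc j)"
    by (subst sum.atMost_Suc_shift) (simp add: US_entry)
  also have "\<dots> = (\<Sum>j\<le>i. nat_multiple (i choose j) ((ad a ^^ (i - j)) b) * a ^ j * a)"
    by (rule sum.cong)
       (simp_all add: US_entry U_entry less mult.assoc power_commutes)
  also have "\<dots> = a ^ i * b * a"
    by (simp only: power_mult_eq_sum_ad sum_distrib_right)
  finally show ?thesis
    by (simp only: mult.assoc)
qed

text \<open>
  The induction peels one factor \<open>U\<^sub>b S\<close> off the right of the power and applies it to \<open>H\<^sub>1\<close>. In row
  \<open>i\<close> the remaining power only meets rows up to \<open>i + n\<close> of the result, where \<open>i + n + 1 < m\<close> holds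
  and the result is \<open>H\<^bsub>ba\<^esub>\<close>; the factor \<open>ba\<close> can then be taken out to the right.
\<close>

lemma power_US_row_times_H:
  fixes a b :: "'a::{ring, monoid_mult}"
  assumes "enat (i + n) < m"
  shows "(\<Sum>k\<le>i + n. matrix_power m (U_mat m a b \<bullet>\<^sub>m S_mat m) n i k * a ^ k) = a ^ i * (b * a) ^ n"
  using assms
proof (induction n)
  case 0
  then have "(\<Sum>k\<le>i + 0. matrix_power m (U_mat m a b \<bullet>\<^sub>m S_mat m) 0 i k * a ^ k)
      = (\<Sum>k\<le>i. if k = i then a ^ i else 0)"
    by (intro sum.cong) (auto simp: identity_matrix_def mk_matrix_def)
  then show ?case by simp
next
  case (Suc n)
  let ?A = "U_mat m a b \<bullet>\<^sub>m S_mat m"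
  let ?P = "matrix_power m ?A n"
  have less: "enat j < m" if "j \<le> Suc (i + n)" for j
    using that Suc.prems by (metis add_Suc_right enat_ord_simps(1) le_less_trans)
  have entry: "matrix_power m ?A (Suc n) i k = (\<Sum>j\<le>i + n. ?P i j * ?A j k)" for k
    unfolding matrix_power.simps by (rule matrix_mult_row_bounded) (rule power_US_eq_0)
  have "(\<Sum>k\<le>i + Suc n. matrix_power m ?A (Suc n) i k * a ^ k)
      = (\<Sum>k\<le>Suc (i + n). \<Sum>j\<le>i + n. ?P i j * (?A j k * a ^ k))"
    by (simp only: entry sum_distrib_right mult.assoc add_Suc_right)
  also have "\<dots> = (\<Sum>j\<le>i + n. ?P i j * (\<Sum>k\<le>Suc (i + n). ?A j k * a ^ k))"
    by (subst sum.swap) (simp only: sum_distrib_left)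
  also have "\<dots> = (\<Sum>j\<le>i + n. ?P i j * a ^ j * (b * a))"
    by (rule sum.cong) (simp_all only: US_row_times_H less atMost_iff Suc_le_mono mult.assoc)
  also have "\<dots> = a ^ i * (b * a) ^ n * (b * a)"
    using Suc.IH less[of "i + n"] by (simp flip: sum_distrib_right)
  finally show ?case
    by (simp only: mult.assoc power_Suc2)
qed

theorem theorem2p7:
  fixes m :: enat and a b :: "'a::{ring, monoid_mult}" and n :: nat
  assumes "enat n < m"
  shows "(b * a) ^ n =
    the_entry (matrix_transpose (e_vec m 0) \<bullet>\<^sub>m matrix_power m (U_mat m a b \<bullet>\<^sub>m S_mat m) n \<bullet>\<^sub>m H_vec m a 1)"
proof -
  let ?P = "matrix_power m (U_mat m a b \<bullet>\<^sub>m S_mat m) n"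
  let ?e = "matrix_transpose (e_vec m 0) :: 'a matrix"
  have less: "enat k < m" if "k \<le> n" for k
    using that assms by (meson enat_ord_simps(1) le_less_trans)
  have row: "(?e \<bullet>\<^sub>m ?P) 0 k = ?P 0 k" for k
  proof -
    have "(?e \<bullet>\<^sub>m ?P) 0 k = (\<Sum>j\<le>0. ?e 0 j * ?P j k)"
      by (rule matrix_mult_row_bounded) (simp add: matrix_transpose_def e_vec_def mk_matrix_def)
    also have "\<dots> = ?P 0 k"
      using less[of 0]
      by (simp add: matrix_transpose_def e_vec_def mk_matrix_def zero_enat_def one_enat_def)
    finally show ?thesis .
  qed
  have "the_entry (?e \<bullet>\<^sub>m ?P \<bullet>\<^sub>m H_vec m a 1) = (\<Sum>k\<le>n. (?e \<bullet>\<^sub>m ?P) 0 k * H_vec m a 1 k 0)"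
    unfolding the_entry_def by (rule matrix_mult_row_bounded) (simp add: row power_US_eq_0)
  also have "\<dots> = (\<Sum>k\<le>0 + n. ?P 0 k * a ^ k)"
    by (rule sum.cong)
       (simp_all add: row less H_vec_def mk_matrix_def zero_enat_def one_enat_def)
  also have "\<dots> = (b * a) ^ n"
    using power_US_row_times_H[of 0 n m a b] assms by simp
  finally show ?thesis by simp
qed

end
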